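(* Let $\Delta,\bar d\ge 1$ be integers, $\tau>0$, $\sigma>0$, and $\delta\in(0,1)$. The truncated Gaussian procedure $\mathrm{TruncGauss}^{\Delta,\bar d,\tau}$ (described in the context, run with noise parameter $\sigma$ and truncation level $T$ determined by $\delta$), applied to histograms in which a user can change at most $\Delta$ counts, each by at most $\tau$, is $\delta$-approximately $\left(0,\frac{\Delta}{2\sigma^2}\right)$-zCDP.
   Context: Let $\phi,\Phi$ be the standard normal density and distribution function. For $T>0$, $N_T(\mu,s^2)$ denotes the symmetric truncated Gaussian with density $f_T(z;\mu,s)=\frac{1}{s}\frac{\phi((z-\mu)/s)}{\Phi(T/s)-\Phi(-T/s)}$ for $\mu-T\le z\le\mu+T$ and $0$ otherwise. Datasets induce histograms $\mathbf{h}$ of nonnegative counts over a (possibly unknown) set of elements, at most $\bar d$ of which have nonzero count. Neighboring datasets induce histograms that differ in at most $\Delta$ counts ($\ell_0$-sensitivity $\Delta$), each by at most $\tau$ ($\ell_\infty$-sensitivity $\tau$). Procedure $\mathrm{TruncGauss}^{\Delta,\bar d,\tau}$: sort the counts $h_{(1)}\ge h_{(2)}\ge\cdots\ge h_{(\bar d+1)}=0$. Let $T$ be a solution of $$\delta=\Delta\left(1-\frac{\Phi\left(\frac{T}{\tau\sigma}\right)-\Phi\left(\frac{\tau-T}{\tau\sigma}\right)}{\Phi\left(\frac{T}{\tau\sigma}\right)-\Phi\left(\frac{-T}{\tau\sigma}\right)}\right).$$ For each of the top $\bar d$ elements, independently draw $v_i\sim N_T(h_{(i)},\tau^2\sigma^2)$;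 if $v_i>\tau+T$, add the pair (label of the element with count $h_{(i)}$, $v_i$) to the output set $S$ (initially empty). Return $S$. For distributions $P,Q$ on the same domain and $\alpha>1$, $D_\alpha(P\|Q)=\frac{1}{\alpha-1}\ln\mathbb{E}_{z\sim P}\left[\left(\frac{P(z)}{Q(z)}\right)^{\alpha-1}\right]$. A randomized algorithm $M$ is $\delta$-approximately $(\xi,\rho)$-zCDP if for any neighbors $x,x'$ there exist events $E,E'$ (on the randomness of $M(x)$ and of $M(x')$ respectively) with $\Pr[E],\Pr[E']\ge1-\delta$ such that for every $\alpha>1$, $D_\alpha(M(x)|_E\,\|\,M(x')|_{E'})\le\alpha\rho+\xi$ and $D_\alpha(M(x')|_{E'}\,\|\,M(x)|_{E})\le\alpha\rho+\xi$, where $M(x)|_E$ is the distribution of $M(x)$ conditioned on $E$. *)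

theory Defs
  imports "HOL-Probability.Probability" "HOL-Real_Asymp.Real_Asymp"
begin

abbreviation Phi :: "real \<Rightarrow> real" where
  "Phi \<equiv> cdf std_normal_distribution"

(* As for normal_density, the spread is given by the standard deviation s, not the variance:
   N_T(mu, s^2) is trunc_normal T mu s. *)
definition trunc_normal_density :: "real \<Rightarrow> real \<Rightarrow> real \<Rightarrow> real \<Rightarrow> real" where
  "trunc_normal_density T \<mu> s z =
     (if \<mu> - T \<le> z \<and> z \<le> \<mu> + T
      then 1 / s * (std_normal_density ((z - \<mu>) / s) / (Phi (T / s) - Phi (- T / s)))
      else 0)"

definition trunc_normal :: "real \<Rightarrow> real \<Rightarrow> real \<Rightarrow> real measure" where
  "trunc_normal T \<mu> s = density lborel (\<lambda>z. ennreal (trunc_normal_density T \<mu> s z))"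

definition histogram :: "nat \<Rightarrow> ('e \<Rightarrow> real) \<Rightarrow> bool" where
  "histogram d h \<longleftrightarrow>
     (\<forall>a. 0 \<le> h a) \<and> finite {a. h a \<noteq> 0} \<and> card {a. h a \<noteq> 0} \<le> d"

(* For histograms the set of differing elements is finite, so card is its true cardinality. *)
definition within_sensitivity ::
    "nat \<Rightarrow> real \<Rightarrow> ('e \<Rightarrow> real) \<Rightarrow> ('e \<Rightarrow> real) \<Rightarrow> bool" where
  "within_sensitivity \<Delta> \<tau> h h' \<longleftrightarrow>
     card {a. h a \<noteq> h' a} \<le> \<Delta> \<and> (\<forall>a. \<bar>h a - h' a\<bar> \<le> \<tau>)"

(* Ties are broken arbitrarily. *)
definition ranking :: "('e \<Rightarrow> real) \<Rightarrow> 'e list" where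
  "ranking h = (SOME es. distinct es \<and> set es = {a. h a \<noteq> 0} \<and>
                         sorted_wrt (\<lambda>a b. h a \<ge> h b) es)"

(* Ranks count from 0: the i-th largest count h_(i) is rank_count h (i - 1).  Ranks beyond the support
   have count 0; as the set of elements may be unknown (or too small to fill d ranks), they
   carry the placeholder label None. *)
definition rank_label :: "('e \<Rightarrow> real) \<Rightarrow> nat \<Rightarrow> 'e option" where
  "rank_label h i = (if i < length (ranking h) then Some (ranking h ! i) else None)"

definition rank_count :: "('e \<Rightarrow> real) \<Rightarrow> nat \<Rightarrow> real" where
  "rank_count h i = (case rank_label h i of None \<Rightarrow> 0 | Some a \<Rightarrow> h a)"

definition truncation_level :: "nat \<Rightarrow> real \<Rightarrow> real \<Rightarrow> real \<Rightarrow> real \<Rightarrow> bool" where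
  "truncation_level \<Delta> \<tau> \<sigma> \<delta> T \<longleftrightarrow> 0 < T \<and>
     \<delta> = real \<Delta> * (1 - (Phi (T / (\<tau> * \<sigma>)) - Phi ((\<tau> - T) / (\<tau> * \<sigma>))) /
                         (Phi (T / (\<tau> * \<sigma>)) - Phi (- T / (\<tau> * \<sigma>))))"

(* T need not be chosen canonically: results are to hold for every truncation level, and one
   always exists. *)
lemma truncation_level_exists:
  assumes "\<Delta> \<ge> 1" "\<tau> > 0" "\<sigma> > 0" "0 < \<delta>" "\<delta> < 1"
  shows "\<exists>T. truncation_level \<Delta> \<tau> \<sigma> \<delta> T"
proof -
  interpret real_distribution std_normal_distribution by (rule real_dist_normal_dist)
  let ?s = "\<tau> * \<sigma>"
  define f where "f T = real \<Delta> * (1 - (Phi (T / ?s) - Phi ((\<tau> - T) / ?s)) /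
    (Phi (T / ?s) - Phi (- T / ?s)))" for T
  have s: "?s > 0" using assms by simp
  have null: "measure std_normal_distribution {x} = 0" for x
  proof -
    have "emeasure std_normal_distribution {x} = 0"
      by (subst emeasure_density) (auto intro!: nn_integral_null_set simp: null_sets_def)
    then show ?thesis by (simp add: measure_def)
  qed
  have cont: "isCont Phi x" for x by (simp add: isCont_cdf null)
  have pos: "Phi a < Phi b" if "a < b" for a b
  proof (rule ccontr)
    assume "\<not> Phi a < Phi b"
    with cdf_diff_eq[OF that] have "measure std_normal_distribution {a<..b} = 0"
      using measure_nonneg[of std_normal_distribution "{a<..b}"] by linarith
    then have "emeasure std_normal_distribution {a<..b} = 0"
      by (simp add: emeasure_eq_measure)
    then have "{a<..b} \<in> null_sets std_normal_distribution" by auto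
    then have "AE x in lborel. x \<in> {a<..b} \<longrightarrow> ennreal (std_normal_density x) \<le> 0"
      by (subst (asm) null_sets_density_iff) auto
    then have "AE x in lborel. x \<notin> {a<..b}"
    proof eventually_elim
      case (elim x)
      with normal_density_pos[of 1 0 x] show ?case by (auto simp: ennreal_eq_0_iff)
    qed
    then have "emeasure lborel {a<..b} = 0"
      by (subst (asm) AE_iff_null_sets[symmetric]) auto
    with that show False by simp
  qed
  have cf: "isCont f T" if "T > 0" for T
  proof -
    have "Phi (- T / ?s) < Phi (T / ?s)"
      by (rule pos) (use that s in \<open>simp add: field_simps\<close>)
    moreover have c: "isCont (\<lambda>T. Phi (g T)) T" if "isCont g T" for g :: "real \<Rightarrow> real"
      using that cont by (rule isCont_o2)
    ultimately show ?thesis unfolding f_def using s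
      by (intro continuous_intros c) auto
  qed
  have f0: "f (\<tau> / 2) = real \<Delta>" by (simp add: f_def)
  have t1: "((\<lambda>T. Phi (T / ?s)) \<longlongrightarrow> 1) at_top"
    by (rule filterlim_compose[OF cdf_lim_at_top_prob])
       (use assms in real_asymp)
  have t2: "((\<lambda>T. Phi ((\<tau> - T) / ?s)) \<longlongrightarrow> 0) at_top"
    by (rule filterlim_compose[OF cdf_lim_at_bot]) (use assms in real_asymp)
  have t3: "((\<lambda>T. Phi (- T / ?s)) \<longlongrightarrow> 0) at_top"
    by (rule filterlim_compose[OF cdf_lim_at_bot]) (use assms in real_asymp)
  have "(f \<longlongrightarrow> real \<Delta> * (1 - (1 - 0) / (1 - 0))) at_top"
    unfolding f_def by (intro tendsto_intros t1 t2 t3) simp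
  then have "\<forall>\<^sub>F T in at_top. f T < \<delta>" using \<open>0 < \<delta>\<close> by (auto dest: order_tendstoD)
  then obtain b where b: "b \<ge> \<tau> / 2" "f b < \<delta>"
    by (metis eventually_at_top_linorder linear)
  have "\<exists>T. \<tau> / 2 \<le> T \<and> T \<le> b \<and> f T = \<delta>"
    by (rule IVT2) (use assms b f0 cf in auto)
  then obtain T where "\<tau> / 2 \<le> T" "f T = \<delta>" by auto
  then show ?thesis using assms unfolding truncation_level_def f_def
    by (intro exI[of _ T]) auto
qed

(* One run of a randomized algorithm on a given input: the probability space of its randomness
   and the output as a function of that randomness. *)
type_synonym ('w, 'o) randomized = "'w measure \<times> ('w \<Rightarrow> 'o)"

definition randomized_into :: "'o measure \<Rightarrow> ('w, 'o) randomized \<Rightarrow> bool" where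
  "randomized_into N A \<longleftrightarrow> prob_space (fst A) \<and> snd A \<in> fst A \<rightarrow>\<^sub>M N"

definition cond_output :: "'o measure \<Rightarrow> ('w, 'o) randomized \<Rightarrow> 'w set \<Rightarrow> 'o measure" where
  "cond_output N A E = distr (uniform_measure (fst A) E) N (snd A)"

definition trunc_gauss ::
    "nat \<Rightarrow> real \<Rightarrow> real \<Rightarrow> real \<Rightarrow> ('e \<Rightarrow> real) \<Rightarrow> (nat \<Rightarrow> real, ('e option \<times> real) set) randomized" where
  "trunc_gauss d \<tau> \<sigma> T h =
     (PiM {..<d} (\<lambda>i. trunc_normal T (rank_count h i) (\<tau> * \<sigma>)),
      \<lambda>v. {(rank_label h i, v i) | i. i < d \<and> v i > \<tau> + T})"

(* Outputs are random sets of (label, value) pairs, with the usual sigma-algebra generated by the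
   hitting events.  On the outputs whose labels lie in a fixed finite set, with at most one value
   per label, it is the Borel sigma-algebra of the (optional) values. *)
definition released_sets :: "('l \<times> real) set measure" where
  "released_sets = sigma UNIV {{S. S \<inter> (A \<times> B) \<noteq> {}} | A B. B \<in> sets borel}"

(* P(z)/Q(z) is the Radon-Nikodym derivative dP/dQ; the divergence is infinite if P is not
   absolutely continuous with respect to Q.  P and Q are to have the same sigma-algebra. *)
definition renyi_divergence :: "real \<Rightarrow> 'o measure \<Rightarrow> 'o measure \<Rightarrow> ereal" where
  "renyi_divergence \<alpha> P Q =
     (let I = (\<integral>\<^sup>+ z. ennreal (enn2real (RN_deriv Q P z) powr (\<alpha> - 1)) \<partial>P)
      in if absolutely_continuous Q P \<and> I \<noteq> \<infinity>
         then ereal (1 / (\<alpha> - 1) * ln (enn2real I)) else \<infinity>)"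

definition approx_zCDP ::
    "'x set \<Rightarrow> ('x \<Rightarrow> 'x \<Rightarrow> bool) \<Rightarrow> 'o measure \<Rightarrow> ('x \<Rightarrow> ('w, 'o) randomized) \<Rightarrow>
     real \<Rightarrow> real \<Rightarrow> real \<Rightarrow> bool" where
  "approx_zCDP X neighbor N M \<delta> \<xi> \<rho> \<longleftrightarrow>
     (\<forall>x\<in>X. randomized_into N (M x)) \<and>
     (\<forall>x\<in>X. \<forall>x'\<in>X. neighbor x x' \<longrightarrow>
        (\<exists>E \<in> sets (fst (M x)). \<exists>E' \<in> sets (fst (M x')).
           measure (fst (M x)) E \<ge> 1 - \<delta> \<and> measure (fst (M x')) E' \<ge> 1 - \<delta> \<and>
           (\<forall>\<alpha>>1.
              renyi_divergence \<alpha> (cond_output N (M x) E) (cond_output N (M x') E')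
                \<le> ereal (\<alpha> * \<rho> + \<xi>) \<and>
              renyi_divergence \<alpha> (cond_output N (M x') E') (cond_output N (M x) E)
                \<le> ereal (\<alpha> * \<rho> + \<xi>))))"

end

theory Submission
  imports Defs
begin

text \<open>
  Condition each noise variable on the intersection of the two truncation windows around the counts
  \<open>m\<close> and \<open>m'\<close> of the same element in the two histograms. The window is symmetric about
  \<open>(m + m') / 2\<close>, so both conditioned laws are Gaussians with the same normalisation \<open>Z\<close>, and their
  \<open>\<alpha>\<close>-th moment is \<open>exp (\<alpha> (\<alpha> - 1) (m - m')\<^sup>2 / (2 s\<^sup>2))\<close> times the mass that a Gaussian centred at
  \<open>\<alpha> m + (1 - \<alpha>) m'\<close> gives to the window, divided by \<open>Z\<close>. This centre is farther from the midpoint than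
  \<open>m\<close>, so the quotient is at most 1. At most \<open>\<Delta>\<close> elements have different counts, and each of them loses
  probability at most \<open>\<delta> / \<Delta>\<close> by the choice of \<open>T\<close>. An element that is missing from one histogram
  has count at most \<open>\<tau>\<close> in the other and is never released, so given the two events the output is a function
  of the noisy counts of the common elements, and data processing for the Renyi divergence applies.
\<close>

subsection \<open>Renyi divergence of image and product measures\<close>

text \<open>Young's inequality with the conjugate exponents \<open>\<alpha> / (\<alpha> - 1)\<close>
  and \<open>\<alpha>\<close>, applied pointwise to \<open>R x powr (\<alpha> - 1)\<close> and
  \<open>r x\<close> and then integrated against \<open>Q\<close>.\<close>

lemma nn_integral_powr_change_of_measure:
  fixes R r :: "'a \<Rightarrow> real"
  assumes \<alpha>: "\<alpha> > 1"
    and [measurable]: "R \<in> borel_measurable Q" "r \<in> borel_measurable Q"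
    and R: "\<And>x. R x \<ge> 0" and r: "\<And>x. r x \<ge> 0"
  shows "(\<integral>\<^sup>+ x. ennreal (R x powr (\<alpha> - 1)) \<partial>density Q (\<lambda>x. ennreal (r x)))
    \<le> ennreal ((\<alpha> - 1) / \<alpha>) * (\<integral>\<^sup>+ x. ennreal (R x powr \<alpha>) \<partial>Q)
      + ennreal (1 / \<alpha>) * (\<integral>\<^sup>+ x. ennreal (r x powr \<alpha>) \<partial>Q)"
proof -
  have young: "r x * R x powr (\<alpha> - 1) \<le> (\<alpha> - 1) / \<alpha> * R x powr \<alpha> + 1 / \<alpha> * r x powr \<alpha>" for x
  proof -
    have "R x powr (\<alpha> - 1) * r x \<le> (R x powr (\<alpha> - 1)) powr (\<alpha> / (\<alpha> - 1)) / (\<alpha> / (\<alpha> - 1))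
        + r x powr \<alpha> / \<alpha>"
      using \<alpha> R r by (intro Youngs_inequality) (auto simp: field_simps)
    moreover have "(R x powr (\<alpha> - 1)) powr (\<alpha> / (\<alpha> - 1)) = R x powr \<alpha>"
      using \<alpha> by (simp add: powr_powr)
    ultimately show ?thesis by (simp add: mult.commute)
  qed
  have "(\<integral>\<^sup>+ x. ennreal (R x powr (\<alpha> - 1)) \<partial>density Q (\<lambda>x. ennreal (r x)))
      = (\<integral>\<^sup>+ x. ennreal (r x * R x powr (\<alpha> - 1)) \<partial>Q)"
    using r by (simp add: nn_integral_density ennreal_mult')
  also have "\<dots> \<le> (\<integral>\<^sup>+ x. ennreal ((\<alpha> - 1) / \<alpha>) * ennreal (R x powr \<alpha>)
      + ennreal (1 / \<alpha>) * ennreal (r x powr \<alpha>) \<partial>Q)"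
    using young \<alpha> by (intro nn_integral_mono)
      (auto simp flip: ennreal_mult'' ennreal_plus intro!: ennreal_leI)
  also have "\<dots> = ennreal ((\<alpha> - 1) / \<alpha>) * (\<integral>\<^sup>+ x. ennreal (R x powr \<alpha>) \<partial>Q)
      + ennreal (1 / \<alpha>) * (\<integral>\<^sup>+ x. ennreal (r x powr \<alpha>) \<partial>Q)"
    by (simp add: nn_integral_add nn_integral_cmult)
  finally show ?thesis .
qed

text \<open>The term \<open>ennreal (1 - c) * x\<close> is cancelled from both sides, hence the
  finiteness of \<open>x\<close>. It serves to solve a bound in which a moment occurs on both
  sides.\<close>

lemma ennreal_le_of_convex_combination:
  fixes x y :: ennreal
  assumes "x \<le> ennreal (1 - c) * x + ennreal c * y" "x \<noteq> \<infinity>" "0 < c" "c < 1"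
  shows "x \<le> y"
proof (cases y)
  case (real b)
  with assms obtain a where a: "x = ennreal a" "a \<ge> 0" by (cases x) auto
  have "a \<le> (1 - c) * a + c * b"
    using assms real a by (simp flip: ennreal_mult'' ennreal_plus)
  then have "c * a \<le> c * b" by (simp add: algebra_simps)
  then show ?thesis using assms real a by (simp add: ennreal_leI)
qed simp

text \<open>Monotone convergence. The truncated powers are bounded, so a bound proved for finite
  moments extends to the moment of \<open>R\<close> itself.\<close>

lemma nn_integral_powr_SUP_truncation:
  fixes R :: "'a \<Rightarrow> real"
  assumes "\<beta> > 0" and [measurable]: "R \<in> borel_measurable M" and R: "\<And>x. R x \<ge> 0"
  shows "(\<integral>\<^sup>+ x. ennreal (R x powr \<beta>) \<partial>M) = (SUP n. \<integral>\<^sup>+ x. ennreal (min (R x) (real n) powr \<beta>) \<partial>M)"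
proof -
  have "(SUP n. ennreal (min (R x) (real n) powr \<beta>)) = ennreal (R x powr \<beta>)" for x
  proof (rule antisym)
    show "(SUP n. ennreal (min (R x) (real n) powr \<beta>)) \<le> ennreal (R x powr \<beta>)"
      using R assms(1) by (intro SUP_least ennreal_leI powr_mono2) auto
    obtain n where "R x \<le> real n" using real_arch_simple by blast
    then show "ennreal (R x powr \<beta>) \<le> (SUP n. ennreal (min (R x) (real n) powr \<beta>))"
      by (intro SUP_upper2[of n]) auto
  qed
  moreover have "incseq (\<lambda>n x. ennreal (min (R x) (real n) powr \<beta>))"
    using R assms(1) by (auto simp: incseq_def le_fun_def intro!: ennreal_leI powr_mono2)
  ultimately show ?thesis
    by (subst nn_integral_monotone_convergence_SUP[symmetric]) auto
qed

text \<open>Data processing: along \<open>g\<close>, the derivative of the image measures is the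
  conditional expectation of \<open>r\<close>, and averaging can only lower a convex moment. The
  moment of order \<open>\<alpha> - 1\<close> under \<open>P'\<close> corresponds to the one of
  order \<open>\<alpha>\<close> under \<open>Q'\<close>.\<close>

lemma
  fixes r :: "'a \<Rightarrow> real"
  assumes "\<alpha> > 1" "prob_space Q" "prob_space (density Q (\<lambda>x. ennreal (r x)))"
    and [measurable]: "r \<in> borel_measurable Q" "g \<in> Q \<rightarrow>\<^sub>M N" and r: "\<And>x. r x \<ge> 0"
  defines "P' \<equiv> distr (density Q (\<lambda>x. ennreal (r x))) N g" and "Q' \<equiv> distr Q N g"
  shows absolutely_continuous_distr_density: "absolutely_continuous Q' P'"
    and nn_integral_RN_deriv_powr_distr_le:
      "(\<integral>\<^sup>+ z. ennreal (enn2real (RN_deriv Q' P' z) powr (\<alpha> - 1)) \<partial>P')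
        \<le> (\<integral>\<^sup>+ x. ennreal (r x powr \<alpha>) \<partial>Q)"
proof -
  interpret Q: prob_space Q by fact
  interpret P: prob_space "density Q (\<lambda>x. ennreal (r x))" by fact
  interpret Q': prob_space Q' unfolding Q'_def by (rule Q.prob_space_distr) measurable
  interpret P': prob_space P' unfolding P'_def by (rule P.prob_space_distr) measurable
  have [measurable_cong]: "sets P' = sets N" "sets Q' = sets N" by (simp_all add: P'_def Q'_def)
  show ac: "absolutely_continuous Q' P'"
    unfolding absolutely_continuous_def
  proof
    fix A assume "A \<in> null_sets Q'"
    then have A: "A \<in> sets N" "g -` A \<inter> space Q \<in> null_sets Q"
      by (auto simp: Q'_def null_sets_distr_iff)
    have "absolutely_continuous Q (density Q (\<lambda>x. ennreal (r x)))"
      by (rule absolutely_continuousI_density) measurable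
    with A show "A \<in> null_sets P'"
      by (auto simp: P'_def null_sets_distr_iff absolutely_continuous_def)
  qed
  define R where "R = (\<lambda>z. enn2real (RN_deriv Q' P' z))"
  have [measurable]: "R \<in> borel_measurable N"
  proof -
    have "R \<in> borel_measurable Q'" unfolding R_def by measurable
    then show ?thesis by measurable
  qed
  \<comment> \<open>Young's inequality gives \<open>I \<le> (1 - 1/\<alpha>) I + B/\<alpha>\<close> for the moments \<open>I\<close> of the image measures and
    \<open>B\<close> of the original ones. Truncating the derivative makes \<open>I\<close> finite, so that it can be cancelled.\<close>
  define I where "I n = (\<integral>\<^sup>+ z. ennreal (min (R z) (real n) powr (\<alpha> - 1)) \<partial>P')" for n
  have "I n \<le> (\<integral>\<^sup>+ x. ennreal (r x powr \<alpha>) \<partial>Q)" for n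
  proof -
    let ?R = "\<lambda>z. min (R z) (real n)"
    have R: "0 \<le> ?R z" for z by (simp add: R_def)
    have "I n \<le> (\<integral>\<^sup>+ z. ennreal (real n powr (\<alpha> - 1)) \<partial>P')"
      unfolding I_def using R \<open>\<alpha> > 1\<close> by (intro nn_integral_mono ennreal_leI powr_mono2) auto
    also have "\<dots> < \<infinity>" using P'.emeasure_space_1 by (simp add: ennreal_mult_less_top)
    finally have fin: "I n \<noteq> \<infinity>" by simp
    have "(\<integral>\<^sup>+ x. ennreal (?R (g x) powr \<alpha>) \<partial>Q) = (\<integral>\<^sup>+ z. ennreal (?R z powr \<alpha>) \<partial>Q')"
      unfolding Q'_def by (simp add: nn_integral_distr)
    \<comment> \<open>One of the \<open>\<alpha>\<close> factors is bounded by the full derivative,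
      which then turns integration over \<open>Q'\<close> into integration over
      \<open>P'\<close>.\<close>
    also have "\<dots> \<le> (\<integral>\<^sup>+ z. RN_deriv Q' P' z * ennreal (?R z powr (\<alpha> - 1)) \<partial>Q')"
    proof (rule nn_integral_mono)
      fix z
      have "?R z powr \<alpha> = ?R z * ?R z powr (\<alpha> - 1)"
        using R[of z] by (cases "?R z = 0") (auto simp: powr_diff)
      then have "ennreal (?R z powr \<alpha>) = ennreal (?R z) * ennreal (?R z powr (\<alpha> - 1))"
        using R[of z] by (simp add: ennreal_mult'')
      also have "ennreal (?R z) \<le> RN_deriv Q' P' z"
      proof -
        \<comment> \<open>\<open>enn2real\<close> sends infinity to 0, so the inequality also holds
          where the derivative is infinite.\<close>
        have "ennreal (R z) \<le> RN_deriv Q' P' z"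
          unfolding R_def by (cases "RN_deriv Q' P' z") auto
        then show ?thesis by (meson ennreal_leI min.cobounded1 order_trans)
      qed
      finally show "ennreal (?R z powr \<alpha>) \<le> RN_deriv Q' P' z * ennreal (?R z powr (\<alpha> - 1))"
        by (simp add: mult_right_mono)
    qed
    also have "\<dots> = I n"
      unfolding I_def by (rule Q'.RN_deriv_nn_integral[symmetric, OF ac]) (auto simp: P'_def Q'_def)
    finally have J: "(\<integral>\<^sup>+ x. ennreal (?R (g x) powr \<alpha>) \<partial>Q) \<le> I n" .
    have "I n = (\<integral>\<^sup>+ x. ennreal (?R (g x) powr (\<alpha> - 1)) \<partial>density Q (\<lambda>x. ennreal (r x)))"
      unfolding I_def P'_def by (simp add: nn_integral_distr)
    also have "\<dots> \<le> ennreal ((\<alpha> - 1) / \<alpha>) * (\<integral>\<^sup>+ x. ennreal (?R (g x) powr \<alpha>) \<partial>Q)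
      + ennreal (1 / \<alpha>) * (\<integral>\<^sup>+ x. ennreal (r x powr \<alpha>) \<partial>Q)"
      by (rule nn_integral_powr_change_of_measure) (use \<open>\<alpha> > 1\<close> R r in auto)
    also have "\<dots> \<le> ennreal (1 - 1 / \<alpha>) * I n + ennreal (1 / \<alpha>) * (\<integral>\<^sup>+ x. ennreal (r x powr \<alpha>) \<partial>Q)"
      using J \<open>\<alpha> > 1\<close> by (intro add_mono mult_mono) (auto simp: diff_divide_distrib)
    finally show ?thesis
      by (rule ennreal_le_of_convex_combination) (use fin \<open>\<alpha> > 1\<close> in auto)
  qed
  then have "(SUP n. I n) \<le> (\<integral>\<^sup>+ x. ennreal (r x powr \<alpha>) \<partial>Q)" by (rule SUP_least)
  moreover have "(\<integral>\<^sup>+ z. ennreal (R z powr (\<alpha> - 1)) \<partial>P') = (SUP n. I n)"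
    unfolding I_def using \<open>\<alpha> > 1\<close> by (intro nn_integral_powr_SUP_truncation) (auto simp: R_def)
  ultimately show "(\<integral>\<^sup>+ z. ennreal (enn2real (RN_deriv Q' P' z) powr (\<alpha> - 1)) \<partial>P')
        \<le> (\<integral>\<^sup>+ x. ennreal (r x powr \<alpha>) \<partial>Q)"
    by (simp add: R_def)
qed

text \<open>The moment bound has the form \<open>exp ((\<alpha> - 1) * c)\<close> so that the
  logarithm and the factor \<open>1 / (\<alpha> - 1)\<close> leave exactly \<open>c\<close>.\<close>

lemma renyi_divergence_distr_density_le:
  fixes r :: "'a \<Rightarrow> real"
  assumes "\<alpha> > 1" "prob_space Q" "prob_space (density Q (\<lambda>x. ennreal (r x)))"
    and "r \<in> borel_measurable Q" "g \<in> Q \<rightarrow>\<^sub>M N" "\<And>x. r x \<ge> 0"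
    and "(\<integral>\<^sup>+ x. ennreal (r x powr \<alpha>) \<partial>Q) \<le> ennreal (exp ((\<alpha> - 1) * c))" "c \<ge> 0"
  shows "renyi_divergence \<alpha> (distr (density Q (\<lambda>x. ennreal (r x))) N g) (distr Q N g) \<le> ereal c"
proof -
  let ?P = "distr (density Q (\<lambda>x. ennreal (r x))) N g" and ?Q = "distr Q N g"
  let ?I = "\<integral>\<^sup>+ z. ennreal (enn2real (RN_deriv ?Q ?P z) powr (\<alpha> - 1)) \<partial>?P"
  have I: "?I \<le> ennreal (exp ((\<alpha> - 1) * c))"
    using nn_integral_RN_deriv_powr_distr_le[OF assms(1-6)] assms(7) by (rule order_trans)
  then have "?I \<noteq> \<infinity>" by (auto simp: top_unique)
  have "enn2real ?I \<le> exp ((\<alpha> - 1) * c)" using I by (rule enn2real_leI[rotated]) simp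
  then have "ln (enn2real ?I) \<le> (\<alpha> - 1) * c"
  \<comment> \<open>For the value 0 the convention \<open>ln 0 = 0\<close> and
    \<open>c \<ge> 0\<close> give the bound.\<close>
  proof (cases "enn2real ?I = 0")
    case False
    then have "0 < enn2real ?I" using enn2real_nonneg[of ?I] by linarith
    with \<open>enn2real ?I \<le> _\<close> show ?thesis by (metis exp_gt_zero ln_exp ln_le_cancel_iff)
  qed (use assms in auto)
  then have "1 / (\<alpha> - 1) * ln (enn2real ?I) \<le> c" using \<open>\<alpha> > 1\<close> by (simp add: field_simps)
  moreover have "absolutely_continuous ?Q ?P"
    by (rule absolutely_continuous_distr_density[OF assms(1-6)])
  ultimately show ?thesis
    using \<open>?I \<noteq> \<infinity>\<close> by (simp add: renyi_divergence_def Let_def)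
qed

section \<open>Conditioning, densities and divergence of finite products\<close>

text \<open>Both measures give the box \<open>PiE I A\<close> the product of the quotients of the
  masses of \<open>J i \<inter> A i\<close> and \<open>J i\<close>, and boxes determine a finite
  product. So coordinates stay independent when each is conditioned on its own event.\<close>

lemma uniform_measure_PiM_PiE:
  assumes "finite I" and M: "\<And>i. prob_space (M i)" and J: "\<And>i. emeasure (M i) (J i) \<noteq> 0"
  shows "uniform_measure (PiM I M) (PiE I J) = PiM I (\<lambda>i. uniform_measure (M i) (J i))"
proof -
  interpret M: product_prob_space M I by (intro product_prob_spaceI M)
  interpret U: product_prob_space "\<lambda>i. uniform_measure (M i) (J i)" I
    by (intro product_prob_spaceI prob_space_uniform_measure J)
       (use M in \<open>auto simp: prob_space.emeasure_space_1 prob_space_def finite_measure.emeasure_eq_measure\<close>)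
  have sets_J: "J i \<in> sets (M i)" for i using J by (metis emeasure_neq_0_sets)
  have J_pos: "measure (M i) (J i) > 0" for i
    using J[of i] by (simp add: M.M.emeasure_eq_measure zero_less_measure_iff)
  show ?thesis
  proof (rule U.PiM_eqI)
    fix A assume "\<And>i. i \<in> I \<Longrightarrow> A i \<in> sets (uniform_measure (M i) (J i))"
    then have A: "A i \<in> sets (M i)" if "i \<in> I" for i using that by simp
    have emeasure_PiE: "emeasure (PiM I M) (PiE I B) = ennreal (\<Prod>i\<in>I. measure (M i) (B i))"
      if "\<And>i. i \<in> I \<Longrightarrow> B i \<in> sets (M i)" for B
      using that \<open>finite I\<close>
      by (subst M.emeasure_PiM) (auto simp: M.M.emeasure_eq_measure prod_ennreal)
    have "emeasure (uniform_measure (PiM I M) (PiE I J)) (PiE I A)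
        = ennreal (\<Prod>i\<in>I. measure (M i) (J i \<inter> A i)) / ennreal (\<Prod>i\<in>I. measure (M i) (J i))"
      using A sets_J \<open>finite I\<close>
      by (subst emeasure_uniform_measure) (auto simp: PiE_Int emeasure_PiE intro!: sets_PiM_I_finite)
    also have "\<dots> = ennreal (\<Prod>i\<in>I. measure (M i) (J i \<inter> A i) / measure (M i) (J i))"
      using J_pos by (subst divide_ennreal) (auto simp: prod_dividef intro!: prod_nonneg prod_pos)
    also have "\<dots> = (\<Prod>i\<in>I. emeasure (uniform_measure (M i) (J i)) (A i))"
      using A sets_J J_pos
      by (subst prod_ennreal[symmetric])
         (auto simp: M.M.emeasure_eq_measure divide_ennreal intro!: prod.cong)
    finally show "emeasure (uniform_measure (PiM I M) (PiE I J)) (PiE I A)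
        = (\<Prod>i\<in>I. emeasure (uniform_measure (M i) (J i)) (A i))" .
  qed (use \<open>finite I\<close> in \<open>auto intro!: sets_PiM_cong\<close>)
qed

text \<open>By Tonelli the integral of the product over a box factorises into the masses of the
  sides, and boxes determine the product measure.\<close>

lemma density_PiM:
  fixes r :: "'i \<Rightarrow> 'a \<Rightarrow> real"
  assumes "finite I" and M: "\<And>i. prob_space (M i)"
    and D: "\<And>i. prob_space (density (M i) (\<lambda>x. ennreal (r i x)))"
    and [measurable]: "\<And>i. r i \<in> borel_measurable (M i)" and r: "\<And>i x. 0 \<le> r i x"
  shows "density (PiM I M) (\<lambda>w. ennreal (\<Prod>i\<in>I. r i (w i)))
    = PiM I (\<lambda>i. density (M i) (\<lambda>x. ennreal (r i x)))"
proof -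
  interpret M: product_prob_space M I by (intro product_prob_spaceI M)
  interpret D: product_prob_space "\<lambda>i. density (M i) (\<lambda>x. ennreal (r i x))" I
    by (intro product_prob_spaceI D)
  show ?thesis
  proof (rule D.PiM_eqI)
    fix A assume "\<And>i. i \<in> I \<Longrightarrow> A i \<in> sets (density (M i) (\<lambda>x. ennreal (r i x)))"
    then have A [measurable]: "A i \<in> sets (M i)" if "i \<in> I" for i using that by simp
    have "emeasure (density (PiM I M) (\<lambda>w. ennreal (\<Prod>i\<in>I. r i (w i)))) (PiE I A)
        = (\<integral>\<^sup>+ w. ennreal (\<Prod>i\<in>I. r i (w i)) * indicator (PiE I A) w \<partial>PiM I M)"
      using A \<open>finite I\<close> by (intro emeasure_density) (auto intro!: sets_PiM_I_finite)
    also have "\<dots> = (\<integral>\<^sup>+ w. (\<Prod>i\<in>I. ennreal (r i (w i)) * indicator (A i) (w i)) \<partial>PiM I M)"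
    proof (rule nn_integral_cong)
      fix w assume "w \<in> space (PiM I M)"
      then have "indicator (PiE I A) w = (\<Prod>i\<in>I. indicator (A i) (w i) :: ennreal)"
        using \<open>finite I\<close> by (auto simp: indicator_def space_PiM PiE_iff)
      then show "ennreal (\<Prod>i\<in>I. r i (w i)) * indicator (PiE I A) w
          = (\<Prod>i\<in>I. ennreal (r i (w i)) * indicator (A i) (w i))"
        using r by (simp add: prod.distrib prod_ennreal)
    qed
    also have "\<dots> = (\<Prod>i\<in>I. emeasure (density (M i) (\<lambda>x. ennreal (r i x))) (A i))"
      using A \<open>finite I\<close>
      by (subst M.product_nn_integral_prod) (auto simp: emeasure_density intro!: prod.cong)
    finally show "emeasure (density (PiM I M) (\<lambda>w. ennreal (\<Prod>i\<in>I. r i (w i)))) (PiE I A)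
        = (\<Prod>i\<in>I. emeasure (density (M i) (\<lambda>x. ennreal (r i x))) (A i))" .
  qed (use \<open>finite I\<close> in \<open>auto intro!: sets_PiM_cong\<close>)
qed

text \<open>The density ratio of two products is the product of the ratios. By independence its
  moments multiply, so the exponents \<open>c i\<close> add up, and data processing along
  \<open>g\<close> gives the claim.\<close>

lemma renyi_divergence_distr_PiM_le:
  fixes r :: "'i \<Rightarrow> 'a \<Rightarrow> real"
  assumes "\<alpha> > 1" "finite I" and Q: "\<And>i. prob_space (Q i)"
    and P: "\<And>i. prob_space (P i)" and P_eq: "\<And>i. P i = density (Q i) (\<lambda>x. ennreal (r i x))"
    and [measurable]: "\<And>i. r i \<in> borel_measurable (Q i)" and g: "g \<in> PiM I Q \<rightarrow>\<^sub>M N"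
    and r: "\<And>i x. 0 \<le> r i x"
    and le: "\<And>i. i \<in> I \<Longrightarrow> (\<integral>\<^sup>+ x. ennreal (r i x powr \<alpha>) \<partial>Q i) \<le> ennreal (exp ((\<alpha> - 1) * c i))"
    and c: "(\<Sum>i\<in>I. c i) \<le> b" "0 \<le> b"
  shows "renyi_divergence \<alpha> (distr (PiM I P) N g) (distr (PiM I Q) N g) \<le> ereal b"
proof -
  interpret Q: product_prob_space Q I by (intro product_prob_spaceI Q)
  have "density (PiM I Q) (\<lambda>w. ennreal (\<Prod>i\<in>I. r i (w i))) = PiM I P"
    unfolding P_eq using assms(2) Q P[unfolded P_eq] assms(6) r by (rule density_PiM)
  then have P_dens: "PiM I P = density (PiM I Q) (\<lambda>w. ennreal (\<Prod>i\<in>I. r i (w i)))" ..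
  have "(\<integral>\<^sup>+ w. ennreal ((\<Prod>i\<in>I. r i (w i)) powr \<alpha>) \<partial>PiM I Q)
      = (\<integral>\<^sup>+ w. (\<Prod>i\<in>I. ennreal (r i (w i) powr \<alpha>)) \<partial>PiM I Q)"
    using r by (simp add: prod_powr_distrib prod_ennreal)
  also have "\<dots> = (\<Prod>i\<in>I. \<integral>\<^sup>+ x. ennreal (r i x powr \<alpha>) \<partial>Q i)"
    using \<open>finite I\<close> by (intro Q.product_nn_integral_prod) auto
  also have "\<dots> \<le> (\<Prod>i\<in>I. ennreal (exp ((\<alpha> - 1) * c i)))"
    using \<open>finite I\<close> le by (induction I) (auto intro!: mult_mono)
  also have "\<dots> = ennreal (exp ((\<alpha> - 1) * (\<Sum>i\<in>I. c i)))"
    using \<open>finite I\<close> by (simp add: prod_ennreal exp_sum sum_distrib_left)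
  also have "\<dots> \<le> ennreal (exp ((\<alpha> - 1) * b))"
    using c \<open>\<alpha> > 1\<close> by (intro ennreal_leI) auto
  finally show ?thesis
    unfolding P_dens using assms(1) c g r
    by (intro renyi_divergence_distr_density_le)
       (auto simp flip: P_dens intro!: prob_space_PiM P Q prod_nonneg)
qed

subsection \<open>Truncated Gaussians\<close>

text \<open>
  The reflection exchanging \<open>m\<close> and \<open>n\<close> maps the part \<open>S\<close> of the interval to itself; the rest of the
  interval lies on the side of \<open>m\<close>.
\<close>
lemma normal_density_interval_mono:
  assumes "(n - m) * (m + n - a - b) \<ge> 0"
  shows "(\<integral>\<^sup>+ x. ennreal (normal_density n s x * indicator {a..b} x) \<partial>lborel)
    \<le> (\<integral>\<^sup>+ x. ennreal (normal_density m s x * indicator {a..b} x) \<partial>lborel)"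
proof -
  define S where "S = {a..b} \<inter> {m + n - b..m + n - a}"
  let ?D = "{a..b} - S"
  have [measurable]: "S \<in> sets borel" by (simp add: S_def)
  have split: "(\<integral>\<^sup>+ x. ennreal (normal_density k s x * indicator {a..b} x) \<partial>lborel)
    = (\<integral>\<^sup>+ x. ennreal (normal_density k s x * indicator S x) \<partial>lborel)
      + (\<integral>\<^sup>+ x. ennreal (normal_density k s x * indicator ?D x) \<partial>lborel)" for k
    by (subst nn_integral_add[symmetric])
       (auto simp: S_def indicator_def intro!: nn_integral_cong)
  have "(\<integral>\<^sup>+ x. ennreal (normal_density n s x * indicator S x) \<partial>lborel)
    = (\<integral>\<^sup>+ x. ennreal (normal_density n s (m + n - x) * indicator S (m + n - x)) \<partial>lborel)"
    by (subst nn_integral_real_affine[where c = "-1" and t = "m + n"]) auto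
  also have "\<dots> = (\<integral>\<^sup>+ x. ennreal (normal_density m s x * indicator S x) \<partial>lborel)"
    by (intro nn_integral_cong) (auto simp: normal_density_def S_def indicator_def power2_commute)
  finally have reflect: "(\<integral>\<^sup>+ x. ennreal (normal_density n s x * indicator S x) \<partial>lborel)
    = (\<integral>\<^sup>+ x. ennreal (normal_density m s x * indicator S x) \<partial>lborel)" .
  have closer: "normal_density n s x \<le> normal_density m s x" if "x \<in> ?D" for x
  proof -
    have "(x - n)\<^sup>2 - (x - m)\<^sup>2 = (n - m) * (m + n - 2 * x)"
      by (simp add: power2_eq_square algebra_simps)
    moreover have "(n - m) * (m + n - 2 * x) \<ge> 0"
      using assms that by (auto simp: S_def zero_le_mult_iff)
    ultimately have "(x - m)\<^sup>2 \<le> (x - n)\<^sup>2" by simp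
    then have "- (x - n)\<^sup>2 / (2 * s\<^sup>2) \<le> - (x - m)\<^sup>2 / (2 * s\<^sup>2)"
      by (intro divide_right_mono) auto
    then show ?thesis unfolding normal_density_def by (intro mult_left_mono) auto
  qed
  have "(\<integral>\<^sup>+ x. ennreal (normal_density n s x * indicator ?D x) \<partial>lborel)
    \<le> (\<integral>\<^sup>+ x. ennreal (normal_density m s x * indicator ?D x) \<partial>lborel)"
    using closer by (intro nn_integral_mono) (auto simp: indicator_def intro!: ennreal_leI)
  then show ?thesis unfolding split reflect by (rule add_left_mono)
qed

text \<open>Completing the square: the weighted sum of \<open>(x - m)\<^sup>2\<close> and
  \<open>(x - m')\<^sup>2\<close> with weights \<open>\<alpha>\<close> and
  \<open>1 - \<alpha>\<close> is the square about the weighted mean minus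
  \<open>\<alpha> * (\<alpha> - 1) * (m - m')\<^sup>2\<close>. For \<open>\<alpha> > 1\<close> this
  mean lies beyond \<open>m\<close>, as seen from \<open>m'\<close>.\<close>

lemma normal_density_tilt:
  assumes "s \<noteq> 0"
  shows "(normal_density m s x / normal_density m' s x) powr \<alpha> * normal_density m' s x
    = exp (\<alpha> * (\<alpha> - 1) * (m - m')\<^sup>2 / (2 * s\<^sup>2)) * normal_density (\<alpha> * m + (1 - \<alpha>) * m') s x"
proof -
  let ?e = "\<lambda>k. - (x - k)\<^sup>2 / (2 * s\<^sup>2)" and ?n = "\<alpha> * m + (1 - \<alpha>) * m'"
  have "\<alpha> * (x - m)\<^sup>2 + (1 - \<alpha>) * (x - m')\<^sup>2 = (x - ?n)\<^sup>2 - \<alpha> * (\<alpha> - 1) * (m - m')\<^sup>2"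
    by (simp add: power2_eq_square algebra_simps)
  moreover have "\<alpha> * (?e m - ?e m') + ?e m' = - (\<alpha> * (x - m)\<^sup>2 + (1 - \<alpha>) * (x - m')\<^sup>2) / (2 * s\<^sup>2)"
    by (simp add: algebra_simps diff_divide_distrib add_divide_distrib)
  ultimately have *: "\<alpha> * (?e m - ?e m') + ?e m' = \<alpha> * (\<alpha> - 1) * (m - m')\<^sup>2 / (2 * s\<^sup>2) + ?e ?n"
    by (simp add: diff_divide_distrib)
  have "(normal_density m s x / normal_density m' s x) powr \<alpha> = exp (\<alpha> * (?e m - ?e m'))"
    using assms by (simp add: normal_density_def powr_def exp_diff ln_div)
  moreover have nd: "normal_density k s x = 1 / sqrt (2 * pi * s\<^sup>2) * exp (?e k)" for k
    by (simp add: normal_density_def)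
  ultimately have "(normal_density m s x / normal_density m' s x) powr \<alpha> * normal_density m' s x
      = 1 / sqrt (2 * pi * s\<^sup>2) * exp (\<alpha> * (?e m - ?e m') + ?e m')"
    by (simp only: exp_add mult_ac)
  also have "\<dots> = exp (\<alpha> * (\<alpha> - 1) * (m - m')\<^sup>2 / (2 * s\<^sup>2)) * normal_density ?n s x"
    by (simp only: * nd exp_add mult_ac)
  finally show ?thesis .
qed

section \<open>The standard normal distribution function\<close>

lemma emeasure_std_normal_Ioc:
  assumes "a \<le> b"
  shows "emeasure std_normal_distribution {a<..b} = ennreal (Phi b - Phi a)"
proof -
  interpret real_distribution std_normal_distribution by (rule real_dist_normal_dist)
  show ?thesis
    using assms cdf_diff_eq[of a b] by (cases "a = b") (auto simp: emeasure_eq_measure)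
qed

text \<open>The Gaussian density is positive everywhere, so an interval without Gaussian mass would
  be a Lebesgue null set.\<close>

lemma Phi_strict_mono:
  assumes "a < b"
  shows "Phi a < Phi b"
proof (rule ccontr)
  assume "\<not> Phi a < Phi b"
  with assms have "{a<..b} \<in> null_sets std_normal_distribution"
    by (intro null_setsI) (auto simp: emeasure_std_normal_Ioc ennreal_eq_0_iff)
  then have "AE x in lborel. x \<in> {a<..b} \<longrightarrow> ennreal (std_normal_density x) = 0"
    by (subst (asm) null_sets_density_iff) auto
  then have "AE x in lborel. x \<notin> {a<..b}"
  proof eventually_elim
    case (elim x)
    then show ?case using normal_density_pos[of 1 0 x] by (auto simp: ennreal_eq_0_iff)
  qed
  then have "emeasure lborel {a<..b} = 0"
    by (subst (asm) AE_iff_null_sets[symmetric]) auto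
  with assms show False by simp
qed

lemma Phi_mono: "a \<le> b \<Longrightarrow> Phi a \<le> Phi b"
  using Phi_strict_mono[of a b] by (cases "a = b") auto

lemma nn_integral_normal_density_Icc:
  assumes "s > 0" "a \<le> b"
  shows "(\<integral>\<^sup>+ x. ennreal (normal_density m s x * indicator {a..b} x) \<partial>lborel)
    = ennreal (Phi ((b - m) / s) - Phi ((a - m) / s))"
proof -
  have "(\<integral>\<^sup>+ x. ennreal (normal_density m s x * indicator {a..b} x) \<partial>lborel)
    = ennreal s * (\<integral>\<^sup>+ x. ennreal (normal_density m s (m + s * x) * indicator {a..b} (m + s * x)) \<partial>lborel)"
    using assms by (subst nn_integral_real_affine[where c = s and t = m]) auto
  also have "\<dots> = (\<integral>\<^sup>+ x. ennreal s *
      ennreal (normal_density m s (m + s * x) * indicator {a..b} (m + s * x)) \<partial>lborel)"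
    by (simp add: nn_integral_cmult)
  \<comment> \<open>Differences of \<open>Phi\<close> measure half-open intervals, so the left
    endpoint is dropped, which changes the integrand at a single point only.\<close>
  also have "\<dots> = (\<integral>\<^sup>+ x. ennreal (std_normal_density x) * indicator {(a - m) / s<..(b - m) / s} x \<partial>lborel)"
  proof (rule nn_integral_cong_AE)
    have std: "s * normal_density m s (m + s * x) = std_normal_density x" for x
      using assms by (simp add: normal_density_def real_sqrt_mult power_mult_distrib)
    show "AE x in lborel. ennreal s *
        ennreal (normal_density m s (m + s * x) * indicator {a..b} (m + s * x))
      = ennreal (std_normal_density x) * indicator {(a - m) / s<..(b - m) / s} x"
      using AE_lborel_singleton[of "(a - m) / s"]
    proof eventually_elim
      case (elim x)
      then have "indicator {a..b} (m + s * x) = (indicator {(a - m) / s<..(b - m) / s} x :: real)"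
        using assms by (auto simp: indicator_def field_simps less_le)
      then show ?case
        using std[of x] assms by (simp add: indicator_def flip: ennreal_mult'')
    qed
  qed
  also have "\<dots> = emeasure std_normal_distribution {(a - m) / s<..(b - m) / s}"
    by (simp add: emeasure_density)
  also have "\<dots> = ennreal (Phi ((b - m) / s) - Phi ((a - m) / s))"
    using assms by (intro emeasure_std_normal_Ioc) (simp add: divide_right_mono)
  finally show ?thesis .
qed

section \<open>Truncated Gaussians as probability measures\<close>

lemma sets_trunc_normal [simp]: "sets (trunc_normal T m s) = sets borel"
  by (simp add: trunc_normal_def)

lemma trunc_normal_density_eq:
  assumes "s > 0"
  shows "trunc_normal_density T m s x
    = normal_density m s x * indicator {m - T..m + T} x / (Phi (T / s) - Phi (- T / s))"
proof -
  have "1 / s * std_normal_density ((x - m) / s) = normal_density m s x"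
    using assms by (simp add: normal_density_def real_sqrt_mult power_divide mult_ac)
  then show ?thesis by (simp add: trunc_normal_density_def)
qed

lemma emeasure_trunc_normal_Icc:
  assumes "s > 0" "T > 0" "a \<le> b" "m - T \<le> a" "b \<le> m + T"
  shows "emeasure (trunc_normal T m s) {a..b}
    = ennreal ((Phi ((b - m) / s) - Phi ((a - m) / s)) / (Phi (T / s) - Phi (- T / s)))"
proof -
  let ?K = "Phi (T / s) - Phi (- T / s)"
  have K: "?K > 0" using assms Phi_strict_mono[of "- T / s" "T / s"] by (simp add: divide_strict_right_mono)
  have [measurable]: "trunc_normal_density T m s \<in> borel_measurable borel"
    unfolding trunc_normal_density_def by measurable
  have "emeasure (trunc_normal T m s) {a..b}
      = (\<integral>\<^sup>+ x. ennreal (1 / ?K) * ennreal (normal_density m s x * indicator {a..b} x) \<partial>lborel)"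
    unfolding trunc_normal_def using assms K
    by (subst emeasure_density)
       (auto simp: trunc_normal_density_eq indicator_def simp flip: ennreal_mult''
          intro!: nn_integral_cong)
  also have "\<dots> = ennreal (1 / ?K) * (\<integral>\<^sup>+ x. ennreal (normal_density m s x * indicator {a..b} x) \<partial>lborel)"
    by (intro nn_integral_cmult) measurable
  also have "\<dots> = ennreal ((Phi ((b - m) / s) - Phi ((a - m) / s)) / ?K)"
    using assms K by (subst nn_integral_normal_density_Icc) (auto simp flip: ennreal_mult')
  finally show ?thesis .
qed

lemma prob_space_trunc_normal:
  assumes "s > 0" "T > 0"
  shows "prob_space (trunc_normal T m s)"
proof
  have null: "trunc_normal_density T m s x = 0" if "x \<notin> {m - T..m + T}" for x
    using that by (auto simp: trunc_normal_density_def)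
  have [measurable]: "trunc_normal_density T m s \<in> borel_measurable borel"
    unfolding trunc_normal_density_def by measurable
  have "emeasure (trunc_normal T m s) (space (trunc_normal T m s))
      = emeasure (trunc_normal T m s) {m - T..m + T}"
    unfolding trunc_normal_def using null
    by (auto simp: emeasure_density indicator_def intro!: nn_integral_cong)
  also have "\<dots> = 1"
    using assms Phi_strict_mono[of "- T / s" "T / s"]
    by (subst emeasure_trunc_normal_Icc) (auto simp: divide_strict_right_mono)
  finally show "emeasure (trunc_normal T m s) (space (trunc_normal T m s)) = 1" .
qed

section \<open>Truncated Gaussians conditioned on the common window\<close>

text \<open>The intersection of the supports of the truncated Gaussians centred at \<open>m\<close>
  and \<open>m'\<close>.\<close>

definition common_window :: "real \<Rightarrow> real \<Rightarrow> real \<Rightarrow> real set" where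
  "common_window T m m' = {max m m' - T..min m m' + T}"

text \<open>The mass that the untruncated Gaussian centred at \<open>m\<close>, or equally at
  \<open>m'\<close>, gives to the common window. The formula is written for the smaller centre, from
  which the window reaches from \<open>\<bar>m - m'\<bar> - T\<close> to \<open>T\<close>. At
  distance \<open>\<tau>\<close> it is the numerator in the equation for the truncation
  level.\<close>

definition common_mass :: "real \<Rightarrow> real \<Rightarrow> real \<Rightarrow> real \<Rightarrow> real" where
  "common_mass T s m m' = Phi (T / s) - Phi ((\<bar>m - m'\<bar> - T) / s)"

lemma common_window_commute: "common_window T m m' = common_window T m' m"
  by (simp add: common_window_def max.commute min.commute)

lemma common_mass_pos:
  assumes "s > 0" "\<bar>m - m'\<bar> < 2 * T"
  shows "common_mass T s m m' > 0"
  unfolding common_mass_def using assms Phi_strict_mono[of "(\<bar>m - m'\<bar> - T) / s" "T / s"]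
  by (simp add: divide_strict_right_mono)

lemma nn_integral_normal_density_common_window:
  assumes "s > 0" "\<bar>m - m'\<bar> < 2 * T"
  shows "(\<integral>\<^sup>+ x. ennreal (normal_density m s x * indicator (common_window T m m') x) \<partial>lborel)
    = ennreal (common_mass T s m m')"
proof -
  \<comment> \<open>The endpoints of the window add up to \<open>m + m'\<close>, so the sign
    condition of the comparison lemma holds with value 0 in both directions.\<close>
  have eq: "(\<integral>\<^sup>+ x. ennreal (normal_density m s x * indicator (common_window T m m') x) \<partial>lborel)
    = (\<integral>\<^sup>+ x. ennreal (normal_density (min m m') s x * indicator (common_window T m m') x) \<partial>lborel)"
    unfolding common_window_def by (intro antisym normal_density_interval_mono) (auto simp: min_def max_def)
  have "max m m' - T - min m m' = \<bar>m - m'\<bar> - T" "max m m' - T \<le> min m m' + T"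
    using assms by linarith+
  then show ?thesis unfolding eq unfolding common_window_def using assms
    by (subst nn_integral_normal_density_Icc) (simp_all only: common_mass_def add_diff_cancel_left')
qed

lemma emeasure_trunc_normal_common_window:
  assumes "s > 0" "T > 0" "\<bar>m - m'\<bar> < 2 * T"
  shows "emeasure (trunc_normal T m s) (common_window T m m')
    = ennreal (common_mass T s m m' / (Phi (T / s) - Phi (- T / s)))"
proof -
  let ?a = "max m m' - T" and ?b = "min m m' + T"
  have "?a < ?b" using assms by linarith
  then have "?a \<le> ?b" by simp
  moreover have "(\<integral>\<^sup>+ x. ennreal (normal_density m s x * indicator {?a..?b} x) \<partial>lborel)
    = ennreal (common_mass T s m m')"
    using nn_integral_normal_density_common_window[OF assms(1,3)] by (simp add: common_window_def)
  \<comment> \<open>Two evaluations of one Gaussian integral are equated, which handles both orders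
    of \<open>m\<close> and \<open>m'\<close> at once. Both sides are positive, so
    \<open>ennreal\<close> can be removed.\<close>
  ultimately have "ennreal (Phi ((?b - m) / s) - Phi ((?a - m) / s)) = ennreal (common_mass T s m m')"
    using assms by (simp add: nn_integral_normal_density_Icc)
  moreover have "Phi ((?a - m) / s) < Phi ((?b - m) / s)"
    using \<open>?a < ?b\<close> \<open>s > 0\<close> by (intro Phi_strict_mono divide_strict_right_mono) auto
  ultimately have "Phi ((?b - m) / s) - Phi ((?a - m) / s) = common_mass T s m m'"
    using common_mass_pos[OF assms(1,3)] by (subst (asm) ennreal_inj) auto
  then show ?thesis
    unfolding common_window_def using assms \<open>?a \<le> ?b\<close> by (subst emeasure_trunc_normal_Icc) auto
qed

definition cond_trunc_normal :: "real \<Rightarrow> real \<Rightarrow> real \<Rightarrow> real \<Rightarrow> real measure" where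
  "cond_trunc_normal T s m m' = uniform_measure (trunc_normal T m s) (common_window T m m')"

text \<open>The normaliser \<open>?K\<close> of the truncation cancels against the one in the mass
  of the window, and only the mass \<open>?Z\<close> remains, which does not change when
  \<open>m\<close> and \<open>m'\<close> are exchanged.\<close>

lemma cond_trunc_normal_eq:
  assumes "s > 0" "T > 0" "\<bar>m - m'\<bar> < 2 * T"
  shows "cond_trunc_normal T s m m' = density lborel
    (\<lambda>x. ennreal (normal_density m s x * indicator (common_window T m m') x / common_mass T s m m'))"
proof -
  let ?J = "common_window T m m'" and ?K = "Phi (T / s) - Phi (- T / s)" and ?Z = "common_mass T s m m'"
  have K: "?K > 0" using assms Phi_strict_mono[of "- T / s" "T / s"] by (simp add: divide_strict_right_mono)
  have Z: "?Z > 0" using assms by (intro common_mass_pos)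
  have [measurable]: "trunc_normal_density T m s \<in> borel_measurable borel"
    unfolding trunc_normal_density_def by measurable
  have [measurable]: "?J \<in> sets borel" by (simp add: common_window_def)
  have "ennreal (trunc_normal_density T m s x) * (indicator ?J x / ennreal (?Z / ?K))
      = ennreal (normal_density m s x * indicator ?J x / ?Z)" for x
  proof (cases "x \<in> ?J")
    case True
    then have "x \<in> {m - T..m + T}" by (auto simp: common_window_def)
    then have "trunc_normal_density T m s x = normal_density m s x / ?K"
      using assms by (simp only: trunc_normal_density_eq indicator_simps mult_1_right)
    moreover have "1 / ennreal (?Z / ?K) = ennreal (?K / ?Z)"
      using K Z by (subst ennreal_1[symmetric], subst divide_ennreal) auto
    ultimately show ?thesis
      using True K Z by (simp flip: ennreal_mult'')
  qed (simp add: ennreal_zero_divide)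
  then show ?thesis
    unfolding cond_trunc_normal_def uniform_measure_def emeasure_trunc_normal_common_window[OF assms]
    by (simp add: trunc_normal_def density_density_eq)
qed

lemma emeasure_trunc_normal_common_window_nonzero:
  assumes "s > 0" "T > 0" "\<bar>m - m'\<bar> < 2 * T"
  shows "emeasure (trunc_normal T m s) (common_window T m m') \<noteq> 0"
  using divide_pos_pos[OF common_mass_pos[of s m m' T], of "Phi (T / s) - Phi (- T / s)"]
    Phi_strict_mono[of "- T / s" "T / s"] assms
  by (simp add: emeasure_trunc_normal_common_window ennreal_eq_0_iff divide_strict_right_mono not_le)

lemma prob_space_cond_trunc_normal:
  assumes "s > 0" "T > 0" "\<bar>m - m'\<bar> < 2 * T"
  shows "prob_space (cond_trunc_normal T s m m')"
proof -
  interpret prob_space "trunc_normal T m s" using assms by (intro prob_space_trunc_normal)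
  show ?thesis unfolding cond_trunc_normal_def
    using emeasure_trunc_normal_common_window_nonzero[OF assms]
    by (intro prob_space_uniform_measure) auto
qed

lemma sets_cond_trunc_normal [measurable_cong]: "sets (cond_trunc_normal T s m m') = sets borel"
  by (simp add: cond_trunc_normal_def trunc_normal_def)

text \<open>Window and normaliser are common to both laws, so the indicator and the mass drop out of
  the ratio.\<close>

lemma cond_trunc_normal_density_ratio:
  assumes "s > 0" "T > 0" "\<bar>m - m'\<bar> < 2 * T"
  shows "cond_trunc_normal T s m m' = density (cond_trunc_normal T s m' m)
    (\<lambda>x. ennreal (normal_density m s x / normal_density m' s x))"
proof -
  have [measurable]: "common_window T m m' \<in> sets borel" by (simp add: common_window_def)
  have mass: "common_mass T s m' m = common_mass T s m m'"
    by (simp add: common_mass_def abs_minus_commute)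
  have "normal_density m' s x * indicator (common_window T m m') x / common_mass T s m m'
      * (normal_density m s x / normal_density m' s x)
    = normal_density m s x * indicator (common_window T m m') x / common_mass T s m m'" for x
    using assms normal_density_pos[of s m' x] by simp
  then show ?thesis
    using assms common_mass_pos[of s m m' T]
    by (simp add: cond_trunc_normal_eq abs_minus_commute mass common_window_commute[of T m' m]
        density_density_eq flip: ennreal_mult'')
qed

text \<open>Tilting pulls out the factor \<open>?e\<close> and leaves a Gaussian centred at
  \<open>?n\<close>, whose mass on the window is at most \<open>?Z\<close> and so is absorbed by the
  normaliser.\<close>

lemma nn_integral_ratio_powr_cond_trunc_normal_le:
  assumes "s > 0" "T > 0" "\<bar>m - m'\<bar> < 2 * T" "\<alpha> > 1"
  shows "(\<integral>\<^sup>+ x. ennreal ((normal_density m s x / normal_density m' s x) powr \<alpha>)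
      \<partial>cond_trunc_normal T s m' m)
    \<le> ennreal (exp (\<alpha> * (\<alpha> - 1) * (m - m')\<^sup>2 / (2 * s\<^sup>2)))"
proof -
  let ?J = "common_window T m m'" and ?Z = "common_mass T s m m'"
    and ?n = "\<alpha> * m + (1 - \<alpha>) * m'" and ?e = "exp (\<alpha> * (\<alpha> - 1) * (m - m')\<^sup>2 / (2 * s\<^sup>2))"
  have [measurable]: "?J \<in> sets borel" by (simp add: common_window_def)
  have Z: "?Z > 0" using assms by (intro common_mass_pos)
  have mass: "common_mass T s m' m = ?Z"
    by (simp add: common_mass_def abs_minus_commute)
  have tilt: "normal_density m' s x * indicator ?J x / ?Z * (normal_density m s x / normal_density m' s x) powr \<alpha>
      = ?e / ?Z * (normal_density ?n s x * indicator ?J x)" for x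
  proof -
    have "normal_density m' s x * indicator ?J x / ?Z * (normal_density m s x / normal_density m' s x) powr \<alpha>
      = ((normal_density m s x / normal_density m' s x) powr \<alpha> * normal_density m' s x) * indicator ?J x / ?Z"
      by simp
    also have "\<dots> = ?e / ?Z * (normal_density ?n s x * indicator ?J x)"
      using assms by (subst normal_density_tilt) auto
    finally show ?thesis .
  qed
  have "(\<integral>\<^sup>+ x. ennreal ((normal_density m s x / normal_density m' s x) powr \<alpha>) \<partial>cond_trunc_normal T s m' m)
    = (\<integral>\<^sup>+ x. ennreal (normal_density m' s x * indicator ?J x / ?Z)
        * ennreal ((normal_density m s x / normal_density m' s x) powr \<alpha>) \<partial>lborel)"
    using assms by (simp add: cond_trunc_normal_eq abs_minus_commute mass common_window_commute[of T m' m]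
        nn_integral_density)
  also have "\<dots> = (\<integral>\<^sup>+ x. ennreal (?e / ?Z) * ennreal (normal_density ?n s x * indicator ?J x) \<partial>lborel)"
    using Z by (intro nn_integral_cong) (simp only: tilt powr_ge_zero less_imp_le
        exp_ge_zero divide_nonneg_pos flip: ennreal_mult'' ennreal_mult')
  also have "\<dots> = ennreal (?e / ?Z) * (\<integral>\<^sup>+ x. ennreal (normal_density ?n s x * indicator ?J x) \<partial>lborel)"
    by (intro nn_integral_cmult) measurable
  also have "\<dots> \<le> ennreal (?e / ?Z) * (\<integral>\<^sup>+ x. ennreal (normal_density m s x * indicator ?J x) \<partial>lborel)"
  proof (intro mult_left_mono)
    \<comment> \<open>The product has the sign of the difference of the squared distances of
      \<open>?n\<close> and \<open>m\<close> from the midpoint of the window; so \<open>?n\<close>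
      is at least as far away as \<open>m\<close>.\<close>
    have "(?n - m) * (m + ?n - (max m m' - T) - (min m m' + T)) = \<alpha> * (\<alpha> - 1) * (m - m')\<^sup>2"
      by (simp add: max_def min_def power2_eq_square algebra_simps)
    then show "(\<integral>\<^sup>+ x. ennreal (normal_density ?n s x * indicator ?J x) \<partial>lborel)
      \<le> (\<integral>\<^sup>+ x. ennreal (normal_density m s x * indicator ?J x) \<partial>lborel)"
      unfolding common_window_def using assms by (intro normal_density_interval_mono) auto
  qed simp
  also have "\<dots> = ennreal ?e"
    using assms Z by (simp add: nn_integral_normal_density_common_window flip: ennreal_mult'')
  finally show ?thesis .
qed

subsection \<open>The truncated Gaussian procedure\<close>

lemma
  assumes "histogram d h"
  shows distinct_ranking: "distinct (ranking h)"
    and set_ranking: "set (ranking h) = {a. h a \<noteq> 0}"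
    and length_ranking: "length (ranking h) \<le> d"
proof -
  obtain xs where xs: "distinct xs" "set xs = {a. h a \<noteq> 0}"
    using assms finite_distinct_list by (metis histogram_def)
  \<comment> \<open>A witness for the choice in \<open>ranking\<close>: sorting the support by
    negated counts.\<close>
  have "sorted_wrt (\<lambda>a b. h b \<le> h a) (sort_key (\<lambda>a. - h a) xs)"
    using sorted_sort_key[of "\<lambda>a. - h a" xs] by (simp add: sorted_map)
  with xs have "\<exists>es. distinct es \<and> set es = {a. h a \<noteq> 0} \<and> sorted_wrt (\<lambda>a b. h a \<ge> h b) es"
    by (intro exI[of _ "sort_key (\<lambda>a. - h a) xs"]) auto
  then have *: "distinct (ranking h) \<and> set (ranking h) = {a. h a \<noteq> 0} \<and>
      sorted_wrt (\<lambda>a b. h a \<ge> h b) (ranking h)"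
    unfolding ranking_def by (rule someI_ex)
  then show "distinct (ranking h)" "set (ranking h) = {a. h a \<noteq> 0}" by auto
  with assms show "length (ranking h) \<le> d"
    by (metis distinct_card histogram_def)
qed

text \<open>Labels are attached to indices and not random, so the preimage of a hitting event is a
  finite union of coordinate events over the indices with label in \<open>A\<close>. Hence
  \<open>A\<close> may be arbitrary.\<close>

lemma measurable_released_sets:
  fixes l :: "'i \<Rightarrow> 'l" and M :: "'i \<Rightarrow> real measure"
  assumes "finite I" and M: "\<And>i. i \<in> I \<Longrightarrow> sets (M i) = sets borel"
  shows "(\<lambda>v. {(l i, v i) | i. i \<in> I \<and> v i > c}) \<in> PiM I M \<rightarrow>\<^sub>M released_sets"
  unfolding released_sets_def
proof (rule measurable_measure_of)
  let ?f = "\<lambda>v. {(l i, v i) | i. i \<in> I \<and> v i > c}"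
  fix Y :: "('l \<times> real) set set"
  assume "Y \<in> {{S. S \<inter> (A \<times> B) \<noteq> {}} | A B. B \<in> sets borel}"
  then obtain A B
    where Y: "Y = {S. S \<inter> (A \<times> B) \<noteq> {}}" and B [measurable]: "B \<in> sets borel" by auto
  have "?f -` Y \<inter> space (PiM I M)
      = (\<Union>i\<in>{i \<in> I. l i \<in> A}. (\<lambda>v. v i) -` (B \<inter> {c<..}) \<inter> space (PiM I M))"
    by (auto simp: Y)
  also have "\<dots> \<in> sets (PiM I M)"
  proof (rule sets.finite_UN)
    fix i assume "i \<in> {i \<in> I. l i \<in> A}"
    then have "i \<in> I" by simp
    moreover have "B \<inter> {c<..} \<in> sets (M i)" using M[OF \<open>i \<in> I\<close>] by simp
    ultimately show "(\<lambda>v. v i) -` (B \<inter> {c<..}) \<inter> space (PiM I M) \<in> sets (PiM I M)"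
      by (intro measurable_sets[OF measurable_component_singleton])
  qed (use \<open>finite I\<close> in simp)
  finally show "?f -` Y \<inter> space (PiM I M) \<in> sets (PiM I M)" .
qed auto

lemma randomized_into_trunc_gauss:
  assumes "\<tau> > 0" "\<sigma> > 0" "T > 0"
  shows "randomized_into released_sets (trunc_gauss d \<tau> \<sigma> T h)"
  using assms measurable_released_sets[of "{..<d}"
      "\<lambda>i. trunc_normal T (rank_count h i) (\<tau> * \<sigma>)" "rank_label h" "\<tau> + T"]
  by (auto simp: randomized_into_def trunc_gauss_def intro!: prob_space_PiM prob_space_trunc_normal)

text \<open>The count in \<open>h'\<close> of the element that has rank \<open>i\<close> in \<open>h\<close>.\<close>
definition paired_count :: "('e \<Rightarrow> real) \<Rightarrow> ('e \<Rightarrow> real) \<Rightarrow> nat \<Rightarrow> real" where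
  "paired_count h h' i = (case rank_label h i of None \<Rightarrow> 0 | Some a \<Rightarrow> h' a)"

section \<open>The conditioning events and their probability\<close>

text \<open>The event required by approximate zCDP, indexed by the ranks of \<open>h\<close> because
  the noise is. Exchanging \<open>h\<close> and \<open>h'\<close> gives the event for the other
  histogram.\<close>

definition joint_window :: "nat \<Rightarrow> real \<Rightarrow> ('e \<Rightarrow> real) \<Rightarrow> ('e \<Rightarrow> real) \<Rightarrow> (nat \<Rightarrow> real) set" where
  "joint_window d T h h' = PiE {..<d} (\<lambda>i. common_window T (rank_count h i) (paired_count h h' i))"

lemma sets_joint_window: "joint_window d T h h' \<in> sets (fst (trunc_gauss d \<tau> \<sigma> T h))"
  unfolding joint_window_def trunc_gauss_def
  by (auto simp: common_window_def intro!: sets_PiM_I_finite)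

lemma rank_paired_count_diff_le:
  assumes "\<And>a. \<bar>h a - h' a\<bar> \<le> \<tau>"
  shows "\<bar>rank_count h i - paired_count h h' i\<bar> \<le> \<tau>"
  using assms abs_ge_zero[THEN order_trans, OF assms]
  by (auto simp: rank_count_def paired_count_def split: option.splits)

text \<open>If \<open>2 * T \<le> \<tau>\<close>, the quotient in the defining equation is at most 0
  and its right-hand side at least \<open>\<Delta>\<close>, contradicting
  \<open>\<delta> < 1\<close>. The bound makes every common window an interval of positive
  length.\<close>

lemma truncation_level_gt:
  assumes "\<Delta> \<ge> 1" "\<tau> > 0" "\<sigma> > 0" "\<delta> < 1" "truncation_level \<Delta> \<tau> \<sigma> \<delta> T"
  shows "\<tau> < 2 * T"
proof (rule ccontr)
  let ?s = "\<tau> * \<sigma>"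
  assume "\<not> \<tau> < 2 * T"
  with assms have "Phi (T / ?s) \<le> Phi ((\<tau> - T) / ?s)" by (intro Phi_mono divide_right_mono) auto
  moreover have "Phi (- T / ?s) < Phi (T / ?s)"
    using assms by (intro Phi_strict_mono divide_strict_right_mono) (auto simp: truncation_level_def)
  ultimately have "(Phi (T / ?s) - Phi ((\<tau> - T) / ?s)) / (Phi (T / ?s) - Phi (- T / ?s)) \<le> 0"
    by (intro divide_nonpos_pos) auto
  then have "real \<Delta> * 1 \<le> real \<Delta> * (1 - (Phi (T / ?s) - Phi ((\<tau> - T) / ?s)) / (Phi (T / ?s) - Phi (- T / ?s)))"
    by (intro mult_left_mono) auto
  also have "\<dots> = \<delta>" using assms(5) by (simp add: truncation_level_def)
  finally show False using assms by simp
qed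

text \<open>With loss \<open>q i\<close> at rank \<open>i\<close>, the event has probability the
  product of the \<open>1 - q i\<close>, hence at least 1 minus the sum of the losses. At most
  \<open>\<Delta>\<close> of them are nonzero.\<close>

lemma measure_joint_window_ge:
  assumes "\<Delta> \<ge> 1" "\<tau> > 0" "\<sigma> > 0" "0 < \<delta>" "\<delta> < 1" and T: "truncation_level \<Delta> \<tau> \<sigma> \<delta> T"
    and h: "histogram d h" "histogram d h'" "within_sensitivity \<Delta> \<tau> h h'"
  shows "measure (fst (trunc_gauss d \<tau> \<sigma> T h)) (joint_window d T h h') \<ge> 1 - \<delta>"
proof -
  define s where "s = \<tau> * \<sigma>"
  have "s > 0" "T > 0" "\<tau> < 2 * T"
    using assms truncation_level_gt[of \<Delta> \<tau> \<sigma> \<delta> T] by (auto simp: s_def truncation_level_def)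
  define K where "K = Phi (T / s) - Phi (- T / s)"
  have "K > 0" unfolding K_def diff_gt_0_iff_gt using \<open>s > 0\<close> \<open>T > 0\<close>
    by (intro Phi_strict_mono divide_strict_right_mono) auto
  define x y where "x = rank_count h" and "y = paired_count h h'"
  have "\<bar>h a - h' a\<bar> \<le> \<tau>" for a using h by (auto simp: within_sensitivity_def)
  then have xy: "\<bar>x i - y i\<bar> \<le> \<tau>" for i unfolding x_def y_def by (rule rank_paired_count_diff_le)
  let ?M = "\<lambda>i. trunc_normal T (x i) s" and ?J = "\<lambda>i. common_window T (x i) (y i)"
  define q where "q i = 1 - measure (?M i) (?J i)" for i
  interpret M: product_prob_space ?M "{..<d}"
    using \<open>s > 0\<close> \<open>T > 0\<close> by (intro product_prob_spaceI prob_space_trunc_normal)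
  have q: "q i = 1 - common_mass T s (x i) (y i) / K" for i
    using xy[of i] \<open>s > 0\<close> \<open>T > 0\<close> \<open>\<tau> < 2 * T\<close> \<open>K > 0\<close> common_mass_pos[of s "x i" "y i" T]
    by (simp add: q_def measure_def emeasure_trunc_normal_common_window K_def)
  have q_0: "q i = 0" if "x i = y i" for i
    using that \<open>K > 0\<close> by (simp add: q common_mass_def K_def)
  \<comment> \<open>The common mass decreases with the distance of the counts, and at distance
    \<open>\<tau>\<close> the truncation equation makes the loss exactly
    \<open>\<delta> / \<Delta>\<close>.\<close>
  have q_le: "q i \<le> \<delta> / \<Delta>" for i
  proof -
    have "Phi ((\<bar>x i - y i\<bar> - T) / s) \<le> Phi ((\<tau> - T) / s)"
      using xy[of i] \<open>s > 0\<close> by (intro Phi_mono divide_right_mono) auto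
    then have "(Phi (T / s) - Phi ((\<tau> - T) / s)) / K \<le> common_mass T s (x i) (y i) / K"
      using \<open>K > 0\<close> by (intro divide_right_mono) (auto simp: common_mass_def)
    moreover have "\<delta> / \<Delta> = 1 - (Phi (T / s) - Phi ((\<tau> - T) / s)) / K"
      using T \<open>\<Delta> \<ge> 1\<close> by (simp add: truncation_level_def s_def K_def field_simps)
    ultimately show ?thesis by (simp add: q)
  qed
  define B where "B = {i \<in> {..<d}. x i \<noteq> y i}"
  have "card B \<le> \<Delta>"
  proof -
    \<comment> \<open>Placeholder ranks have count 0 on both sides, so a rank in \<open>B\<close>
      carries an element whose counts differ; distinct ranks carry distinct elements.\<close>
    have rank: "i < length (ranking h) \<and> h (ranking h ! i) \<noteq> h' (ranking h ! i)" if "i \<in> B" for i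
      using that by (auto simp: B_def x_def y_def rank_count_def paired_count_def rank_label_def split: if_splits)
    have "{a. h a \<noteq> h' a} \<subseteq> {a. h a \<noteq> 0} \<union> {a. h' a \<noteq> 0}" by auto
    then have "finite {a. h a \<noteq> h' a}"
      by (rule finite_subset) (use h in \<open>auto simp: histogram_def\<close>)
    moreover have "inj_on (nth (ranking h)) B"
      using rank distinct_ranking[OF h(1)] by (auto simp: inj_on_def nth_eq_iff_index_eq)
    ultimately have "card B \<le> card {a. h a \<noteq> h' a}"
      using rank by (intro card_inj_on_le[of "nth (ranking h)"]) auto
    also have "\<dots> \<le> \<Delta>" using h by (simp add: within_sensitivity_def)
    finally show ?thesis .
  qed
  have "(\<Sum>i<d. q i) = (\<Sum>i\<in>B. q i)"
    by (rule sum.mono_neutral_right) (auto simp: B_def q_0)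
  also have "\<dots> \<le> card B * (\<delta> / \<Delta>)"
    using q_le by (intro sum_bounded_above)
  also have "\<dots> \<le> \<Delta> * (\<delta> / \<Delta>)"
    using \<open>card B \<le> \<Delta>\<close> \<open>\<delta> > 0\<close> by (intro mult_right_mono) auto
  finally have "1 - \<delta> \<le> 1 - (\<Sum>i<d. q i)" using \<open>\<Delta> \<ge> 1\<close> by simp
  also have "\<dots> \<le> (\<Prod>i<d. 1 - q i)"
    by (rule Weierstrass_prod_ineq) (simp add: q_def)
  also have "\<dots> = measure (PiM {..<d} ?M) (PiE {..<d} ?J)"
    unfolding measure_def[of "PiM {..<d} ?M"]
    by (subst M.emeasure_PiM)
       (auto simp: q_def common_window_def M.M.emeasure_eq_measure prod_ennreal prod_nonneg)
  finally show ?thesis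
    by (simp add: trunc_gauss_def joint_window_def x_def y_def s_def)
qed

section \<open>The law of the released set given the event, and its divergence\<close>

text \<open>The two runs rank elements differently. Indexing by the common elements instead removes
  the ranks, so both conditioned outputs become images under the same map, as data processing
  requires.\<close>

lemma cond_output_trunc_gauss:
  assumes "\<tau> > 0" "\<sigma> > 0" "T > 0" "\<tau> < 2 * T"
    and h: "histogram d h" "histogram d h'" and le: "\<And>a. \<bar>h a - h' a\<bar> \<le> \<tau>"
  defines "C \<equiv> {a. h a \<noteq> 0 \<and> h' a \<noteq> 0}"
  shows "cond_output released_sets (trunc_gauss d \<tau> \<sigma> T h) (joint_window d T h h')
    = distr (PiM C (\<lambda>a. cond_trunc_normal T (\<tau> * \<sigma>) (h a) (h' a))) released_sets
        (\<lambda>w. {(Some a, w a) | a. a \<in> C \<and> w a > \<tau> + T})"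
proof -
  define s where "s = \<tau> * \<sigma>"
  have "s > 0" using assms by (simp add: s_def)
  define x y where "x = rank_count h" and "y = paired_count h h'"
  have xy: "\<bar>x i - y i\<bar> < 2 * T" for i
    using rank_paired_count_diff_le[of h h' \<tau> i] le \<open>\<tau> < 2 * T\<close> by (simp add: x_def y_def)
  let ?M = "\<lambda>i. trunc_normal T (x i) s" and ?J = "\<lambda>i. common_window T (x i) (y i)"
    and ?U = "\<lambda>i. cond_trunc_normal T s (x i) (y i)"
  let ?E = "PiE {..<d} ?J"
  have U: "uniform_measure (PiM {..<d} ?M) ?E = PiM {..<d} ?U"
    unfolding cond_trunc_normal_def using \<open>s > 0\<close> \<open>T > 0\<close> xy
    by (intro uniform_measure_PiM_PiE prob_space_trunc_normal emeasure_trunc_normal_common_window_nonzero) auto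
  have prob_U: "prob_space (?U i)" for i
    using \<open>s > 0\<close> \<open>T > 0\<close> xy by (intro prob_space_cond_trunc_normal)
  \<comment> \<open>The rank of an element in \<open>h\<close>, as the inverse of
    \<open>nth (ranking h)\<close>.\<close>
  define idx where "idx = the_inv_into {..<length (ranking h)} (nth (ranking h))"
  have inj: "inj_on (nth (ranking h)) {..<length (ranking h)}"
    using distinct_ranking[OF h(1)] by (auto simp: inj_on_def nth_eq_iff_index_eq)
  have idx: "idx a < length (ranking h)" "ranking h ! idx a = a" if "a \<in> C" for a
  proof -
    have "a \<in> nth (ranking h) ` {..<length (ranking h)}"
      using that set_ranking[OF h(1)] by (simp add: C_def nth_image lessThan_atLeast0)
    then show "idx a < length (ranking h)" "ranking h ! idx a = a"
      unfolding idx_def using the_inv_into_into[OF inj _ subset_refl] f_the_inv_into_f[OF inj] by auto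
  qed
  have idx_d: "idx a < d" if "a \<in> C" for a
    using idx[OF that] length_ranking[OF h(1)] by linarith
  have xy_idx: "x (idx a) = h a" "y (idx a) = h' a" "rank_label h (idx a) = Some a" if "a \<in> C" for a
    using idx[OF that] by (simp_all add: x_def y_def rank_count_def paired_count_def rank_label_def)
  have idx_inj: "inj_on idx C" using idx by (metis inj_on_def)
  have "finite {a. h a \<noteq> 0}" using h by (simp add: histogram_def)
  then have "finite C" by (rule rev_finite_subset) (auto simp: C_def)
  \<comment> \<open>\<open>?t\<close> moves the noisy counts from ranks to elements, and
    \<open>?g\<close> releases them without reference to a ranking.\<close>
  let ?out = "\<lambda>v. {(rank_label h i, v i) | i. i < d \<and> v i > \<tau> + T}"
    and ?t = "\<lambda>v. \<lambda>a\<in>C. v (idx a)" and ?g = "\<lambda>w. {(Some a, w a) | a. a \<in> C \<and> w a > \<tau> + T}"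
  have sets_U: "sets (?U i) = sets borel" for i by (rule sets_cond_trunc_normal)
  have meas_out: "?out \<in> PiM {..<d} ?U \<rightarrow>\<^sub>M released_sets"
    using measurable_released_sets[of "{..<d}" ?U "rank_label h" "\<tau> + T", OF _ sets_U] by simp
  have meas_g: "?g \<in> PiM C (\<lambda>a. ?U (idx a)) \<rightarrow>\<^sub>M released_sets"
    using \<open>finite C\<close> sets_U by (rule measurable_released_sets)
  have meas_t: "?t \<in> PiM {..<d} ?U \<rightarrow>\<^sub>M PiM C (\<lambda>a. ?U (idx a))"
    using idx_d by (intro measurable_restrict measurable_component_singleton) auto
  have eq: "?out v = ?g (?t v)" if "v \<in> ?E" for v
  proof (intro set_eqI iffI)
    fix z assume "z \<in> ?out v"
    then obtain i where i: "i < d" "v i > \<tau> + T" "z = (rank_label h i, v i)" by auto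
    with that have "v i \<in> ?J i" by auto
    \<comment> \<open>From \<open>v i > \<tau> + T\<close> and
      \<open>v i \<le> min (x i) (y i) + T\<close>, both counts exceed \<open>\<tau>\<close>; so the
      rank carries a common element.\<close>
    with i have "x i > 0" "y i > 0" using \<open>\<tau> > 0\<close> by (auto simp: common_window_def)
    then obtain a where a: "rank_label h i = Some a" "h a \<noteq> 0" "h' a \<noteq> 0"
      by (auto simp: x_def y_def rank_count_def paired_count_def split: option.splits)
    then have "a \<in> C" by (simp add: C_def)
    moreover have "i = idx a"
    proof -
      have "i < length (ranking h)" "ranking h ! i = a"
        using a by (auto simp: rank_label_def split: if_splits)
      with idx[OF \<open>a \<in> C\<close>] distinct_ranking[OF h(1)] show ?thesis
        by (metis nth_eq_iff_index_eq)
    qed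
    ultimately show "z \<in> ?g (?t v)" using i a by auto
  next
    fix z assume "z \<in> ?g (?t v)"
    then obtain a where "a \<in> C" "v (idx a) > \<tau> + T" "z = (Some a, v (idx a))" by auto
    then have "z = (rank_label h (idx a), v (idx a)) \<and> idx a < d \<and> v (idx a) > \<tau> + T"
      using idx_d xy_idx(3) by simp
    then show "z \<in> ?out v" by blast
  qed
  have E: "?E \<in> sets (PiM {..<d} ?M)"
    by (auto simp: common_window_def intro!: sets_PiM_I_finite)
  have "AE v in PiM {..<d} ?U. ?out v = ?g (?t v)"
    unfolding U[symmetric] by (rule AE_uniform_measureI[OF E]) (intro AE_I2 impI eq)
  then have "distr (PiM {..<d} ?U) released_sets ?out
      = distr (PiM {..<d} ?U) released_sets (\<lambda>v. ?g (?t v))"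
    by (intro distr_cong_AE refl meas_out measurable_compose[OF meas_t meas_g])
  then have out: "distr (PiM {..<d} ?U) released_sets ?out
      = distr (distr (PiM {..<d} ?U) (PiM C (\<lambda>a. ?U (idx a))) ?t) released_sets ?g"
    by (simp add: distr_distr[OF meas_g meas_t] comp_def)
  \<comment> \<open>\<open>idx\<close> is injective, so selecting these coordinates of a product
    yields the product of the selected factors.\<close>
  have reindex: "distr (PiM {..<d} ?U) (PiM C (\<lambda>a. ?U (idx a))) ?t = PiM C (\<lambda>a. ?U (idx a))"
    by (rule distr_PiM_reindex) (use prob_U idx_inj idx_d in auto)
  have U_idx: "PiM C (\<lambda>a. ?U (idx a)) = PiM C (\<lambda>a. cond_trunc_normal T s (h a) (h' a))"
    by (intro PiM_cong refl) (simp add: xy_idx)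
  have "cond_output released_sets (trunc_gauss d \<tau> \<sigma> T h) (joint_window d T h h')
      = distr (uniform_measure (PiM {..<d} ?M) ?E) released_sets ?out"
    unfolding cond_output_def trunc_gauss_def joint_window_def x_def y_def s_def
    by (simp only: fst_conv snd_conv lessThan_iff)
  then show ?thesis
    unfolding U out reindex unfolding U_idx unfolding s_def .
qed

lemma renyi_divergence_cond_output_trunc_gauss_le:
  assumes "\<tau> > 0" "\<sigma> > 0" "T > 0" "\<tau> < 2 * T" "\<alpha> > 1"
    and h: "histogram d h" "histogram d h'" "within_sensitivity \<Delta> \<tau> h h'"
  shows "renyi_divergence \<alpha>
      (cond_output released_sets (trunc_gauss d \<tau> \<sigma> T h) (joint_window d T h h'))
      (cond_output released_sets (trunc_gauss d \<tau> \<sigma> T h') (joint_window d T h' h))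
    \<le> ereal (\<alpha> * (real \<Delta> / (2 * \<sigma>\<^sup>2)))"
proof -
  define s where "s = \<tau> * \<sigma>"
  have "s > 0" using assms by (simp add: s_def)
  define C where "C = {a. h a \<noteq> 0 \<and> h' a \<noteq> 0}"
  have C': "{a. h' a \<noteq> 0 \<and> h a \<noteq> 0} = C" by (auto simp: C_def)
  have "finite {a. h a \<noteq> 0}" using h by (simp add: histogram_def)
  then have "finite C" by (rule rev_finite_subset) (auto simp: C_def)
  have diff: "\<bar>h a - h' a\<bar> \<le> \<tau>" for a using h by (auto simp: within_sensitivity_def)
  then have diff': "\<bar>h' a - h a\<bar> \<le> \<tau>" for a by (simp add: abs_minus_commute)
  have lt: "\<bar>h a - h' a\<bar> < 2 * T" "\<bar>h' a - h a\<bar> < 2 * T" for a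
    using diff[of a] \<open>\<tau> < 2 * T\<close> by auto
  let ?g = "\<lambda>w. {(Some a, w a) | a. a \<in> C \<and> w a > \<tau> + T}"
    and ?P = "\<lambda>a. cond_trunc_normal T s (h a) (h' a)" and ?Q = "\<lambda>a. cond_trunc_normal T s (h' a) (h a)"
  \<comment> \<open>The exponent of the Gaussian moment bound with the factor
    \<open>\<alpha> - 1\<close> split off.\<close>
  let ?c = "\<lambda>a. \<alpha> * (h a - h' a)\<^sup>2 / (2 * s\<^sup>2)"
  have "renyi_divergence \<alpha> (distr (PiM C ?P) released_sets ?g) (distr (PiM C ?Q) released_sets ?g)
    \<le> ereal (\<alpha> * (real \<Delta> / (2 * \<sigma>\<^sup>2)))"
  proof (rule renyi_divergence_distr_PiM_le)
    show "?P a = density (?Q a) (\<lambda>x. ennreal (normal_density (h a) s x / normal_density (h' a) s x))" for a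
      using \<open>s > 0\<close> \<open>T > 0\<close> lt by (intro cond_trunc_normal_density_ratio)
    show "(\<integral>\<^sup>+ x. ennreal ((normal_density (h a) s x / normal_density (h' a) s x) powr \<alpha>) \<partial>?Q a)
      \<le> ennreal (exp ((\<alpha> - 1) * ?c a))" for a
      using nn_integral_ratio_powr_cond_trunc_normal_le[OF \<open>s > 0\<close> \<open>T > 0\<close> lt(1) \<open>\<alpha> > 1\<close>, of a]
      by (simp add: mult_ac)
    have "(\<Sum>a\<in>C. ?c a) = (\<Sum>a\<in>C \<inter> {a. h a \<noteq> h' a}. ?c a)"
      using \<open>finite C\<close> by (intro sum.mono_neutral_right) auto
    \<comment> \<open>Each difference is at most \<open>\<tau>\<close>, and
      \<open>\<tau>\<^sup>2\<close> cancels against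
      \<open>s\<^sup>2 = \<tau>\<^sup>2 * \<sigma>\<^sup>2\<close>.\<close>
    also have "\<dots> \<le> real (card (C \<inter> {a. h a \<noteq> h' a})) * (\<alpha> / (2 * \<sigma>\<^sup>2))"
    proof (rule sum_bounded_above)
      fix a
      have "(h a - h' a)\<^sup>2 \<le> \<tau>\<^sup>2" using diff[of a]
        using \<open>\<tau> > 0\<close> by (simp add: power2_le_iff_abs_le)
      then have "?c a \<le> \<alpha> * \<tau>\<^sup>2 / (2 * s\<^sup>2)"
        using \<open>\<alpha> > 1\<close> by (intro divide_right_mono mult_left_mono) auto
      then show "?c a \<le> \<alpha> / (2 * \<sigma>\<^sup>2)" using \<open>\<tau> > 0\<close> by (simp add: s_def power_mult_distrib)
    qed
    also have "\<dots> \<le> real \<Delta> * (\<alpha> / (2 * \<sigma>\<^sup>2))"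
    proof (intro mult_right_mono of_nat_mono)
      have "{a. h a \<noteq> h' a} \<subseteq> {a. h a \<noteq> 0} \<union> {a. h' a \<noteq> 0}" by auto
      then have "finite {a. h a \<noteq> h' a}"
        by (rule finite_subset) (use h in \<open>auto simp: histogram_def\<close>)
      then have "card (C \<inter> {a. h a \<noteq> h' a}) \<le> card {a. h a \<noteq> h' a}" by (intro card_mono) auto
      also have "\<dots> \<le> \<Delta>" using h by (simp add: within_sensitivity_def)
      finally show "card (C \<inter> {a. h a \<noteq> h' a}) \<le> \<Delta>" .
    qed (use \<open>\<alpha> > 1\<close> in auto)
    finally show "(\<Sum>a\<in>C. ?c a) \<le> \<alpha> * (real \<Delta> / (2 * \<sigma>\<^sup>2))" by (simp add: mult_ac)
    show "?g \<in> PiM C ?Q \<rightarrow>\<^sub>M released_sets"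
      using \<open>finite C\<close> sets_cond_trunc_normal by (rule measurable_released_sets)
  qed (use \<open>\<alpha> > 1\<close> \<open>finite C\<close> \<open>s > 0\<close> \<open>T > 0\<close> lt in \<open>auto intro!: prob_space_cond_trunc_normal\<close>)
  then show ?thesis
    using cond_output_trunc_gauss[OF assms(1-4) h(1,2) diff]
      cond_output_trunc_gauss[OF assms(1-4) h(2,1) diff']
    by (simp add: C_def[symmetric] C' s_def)
qed

theorem lemma6p4:
  fixes \<Delta> d :: nat and \<tau> \<sigma> \<delta> T :: real
    and X :: "'x set" and neighbor :: "'x \<Rightarrow> 'x \<Rightarrow> bool" and hist :: "'x \<Rightarrow> 'e \<Rightarrow> real"
  assumes "\<Delta> \<ge> 1" "d \<ge> 1" "\<tau> > 0" "\<sigma> > 0" "0 < \<delta>" "\<delta> < 1"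
    and "\<And>x. x \<in> X \<Longrightarrow> histogram d (hist x)"
    and "\<And>x x'. x \<in> X \<Longrightarrow> x' \<in> X \<Longrightarrow> neighbor x x' \<Longrightarrow> within_sensitivity \<Delta> \<tau> (hist x) (hist x')"
    and "truncation_level \<Delta> \<tau> \<sigma> \<delta> T"
  shows "approx_zCDP X neighbor released_sets (\<lambda>x. trunc_gauss d \<tau> \<sigma> T (hist x))
           \<delta> 0 (real \<Delta> / (2 * \<sigma>\<^sup>2))"
  unfolding approx_zCDP_def
proof (intro conjI ballI impI)
  have T: "T > 0" "\<tau> < 2 * T"
    using assms(9) truncation_level_gt[of \<Delta> \<tau> \<sigma> \<delta> T] assms by (auto simp: truncation_level_def)
  show "randomized_into released_sets (trunc_gauss d \<tau> \<sigma> T (hist x))" for x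
    using assms T by (intro randomized_into_trunc_gauss)
  fix x x' assume x: "x \<in> X" "x' \<in> X" "neighbor x x'"
  let ?h = "hist x" and ?h' = "hist x'"
  have h: "histogram d ?h" "histogram d ?h'" "within_sensitivity \<Delta> \<tau> ?h ?h'"
    using assms x by auto
  \<comment> \<open>Sensitivity is symmetric, so the bounds for \<open>?E'\<close> and for the
    reverse divergence are the same lemmas with the histograms exchanged.\<close>
  have "{a. ?h' a \<noteq> ?h a} = {a. ?h a \<noteq> ?h' a}" by auto
  then have h': "within_sensitivity \<Delta> \<tau> ?h' ?h"
    using h(3) by (simp add: within_sensitivity_def abs_minus_commute)
  let ?E = "joint_window d T ?h ?h'" and ?E' = "joint_window d T ?h' ?h"
  show "\<exists>E\<in>sets (fst (trunc_gauss d \<tau> \<sigma> T ?h)). \<exists>E'\<in>sets (fst (trunc_gauss d \<tau> \<sigma> T ?h')).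
      1 - \<delta> \<le> measure (fst (trunc_gauss d \<tau> \<sigma> T ?h)) E \<and>
      1 - \<delta> \<le> measure (fst (trunc_gauss d \<tau> \<sigma> T ?h')) E' \<and>
      (\<forall>\<alpha>>1. renyi_divergence \<alpha> (cond_output released_sets (trunc_gauss d \<tau> \<sigma> T ?h) E)
               (cond_output released_sets (trunc_gauss d \<tau> \<sigma> T ?h') E')
             \<le> ereal (\<alpha> * (real \<Delta> / (2 * \<sigma>\<^sup>2)) + 0) \<and>
             renyi_divergence \<alpha> (cond_output released_sets (trunc_gauss d \<tau> \<sigma> T ?h') E')
               (cond_output released_sets (trunc_gauss d \<tau> \<sigma> T ?h) E)
             \<le> ereal (\<alpha> * (real \<Delta> / (2 * \<sigma>\<^sup>2)) + 0))"
    unfolding add_0_right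
    by (intro bexI[of _ ?E] bexI[of _ ?E'] conjI allI impI sets_joint_window
        measure_joint_window_ge[where \<Delta> = \<Delta>] renyi_divergence_cond_output_trunc_gauss_le
        assms(1-6,9) T h h')
qed

end
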